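(* As quasi-polynomials in $x$ and $y$ with coefficients in the group algebra of $\mathfrak{B}_n$ (that is, for all integers $x,y$), $$\zeta(x)\zeta(y)=\zeta(xy).$$
   Context: Let $n\ge 1$. The hyperoctahedral group $\mathfrak{B}_n$ is the group (under composition of functions, $(\sigma\tau)(i)=\sigma(\tau(i))$) of all bijections $\pi$ of $\{-n,\ldots,-1,0,1,\ldots,n\}$ with $\pi(-i)=-\pi(i)$ for all $i$. For $\pi\in\mathfrak{B}_n$, $\mathrm{des}_A(\pi)=|\{i\in\{1,\ldots,n-1\}:\pi(i)>\pi(i+1)\}|$, $\mathrm{des}_B(\pi)=|\{i\in\{0,\ldots,n-1\}:\pi(i)>\pi(i+1)\}|$ (with $\pi(0)=0$), and $\mathrm{fdes}(\pi)=\mathrm{des}_A(\pi)+\mathrm{des}_B(\pi)$. For an integer $x$, define in the group algebra $\mathbb{Q}[\mathfrak{B}_n]$ $$\zeta(x)=\sum_{\pi\in\mathfrak{B}_n}\binom{\left\lceil\tfrac12(x-\mathrm{fdes}(\pi))\right\rceil+n-1}{n}\,\pi,$$ where $\binom{z}{n}=z(z-1)\cdots(z-n+1)/n!$ is regarded as a polynomial in $z$. *)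

theory Defs
  imports Complex_Main "HOL-Algebra.Module" "HOL-Combinatorics.Permutations"
begin

(* A bijection of {-n,...,n} is represented by its extension to int that is the identity
   outside {-n,...,n}, so equality of elements is equality of functions. *)
definition hyperoctahedral :: "nat \<Rightarrow> (int \<Rightarrow> int) monoid" where
  "hyperoctahedral n =
    \<lparr>carrier = {\<pi>. \<pi> permutes {- int n..int n} \<and> (\<forall>i\<in>{- int n..int n}. \<pi> (- i) = - \<pi> i)},
     monoid.mult = (\<lambda>\<sigma> \<tau>. \<sigma> \<circ> \<tau>), one = id\<rparr>"

definition des_A :: "nat \<Rightarrow> (int \<Rightarrow> int) \<Rightarrow> nat" where
  "des_A n \<pi> = card {i \<in> {1..int n - 1}. \<pi> i > \<pi> (i + 1)}"

definition des_B :: "nat \<Rightarrow> (int \<Rightarrow> int) \<Rightarrow> nat" where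
  "des_B n \<pi> = card {i \<in> {0..int n - 1}. \<pi> i > \<pi> (i + 1)}"

definition fdes :: "nat \<Rightarrow> (int \<Rightarrow> int) \<Rightarrow> nat" where
  "fdes n \<pi> = des_A n \<pi> + des_B n \<pi>"

(* The group algebra k[G]: a finite formal sum of group elements g with coefficients f g is
   represented by its coefficient function f, which vanishes outside the carrier of G. *)
definition group_algebra :: "('g, 'm) monoid_scheme \<Rightarrow> ('k::field, 'g \<Rightarrow> 'k) module" where
  "group_algebra G =
    \<lparr>carrier = {f. finite {g. f g \<noteq> 0} \<and> {g. f g \<noteq> 0} \<subseteq> carrier G},
     monoid.mult = (\<lambda>f h x.
       \<Sum>(g, g') \<in> {(g, g'). f g \<noteq> 0 \<and> h g' \<noteq> 0 \<and> g \<otimes>\<^bsub>G\<^esub> g' = x}. f g * h g'),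
     one = (\<lambda>x. if x = \<one>\<^bsub>G\<^esub> then 1 else 0),
     zero = (\<lambda>x. 0),
     add = (\<lambda>f h x. f x + h x),
     smult = (\<lambda>c f x. c * f x)\<rparr>"

definition zeta :: "nat \<Rightarrow> int \<Rightarrow> (int \<Rightarrow> int) \<Rightarrow> rat" where
  "zeta n x = (\<lambda>\<pi>. if \<pi> \<in> carrier (hyperoctahedral n)
     then (of_int (\<lceil>(of_int (x - int (fdes n \<pi>)) / 2 :: rat)\<rceil> + int n - 1) :: rat) gchoose n
     else 0)"

lemma group_hyperoctahedral: "group (hyperoctahedral n)"
proof (rule groupI)
  fix \<pi> assume "\<pi> \<in> carrier (hyperoctahedral n)"
  then have p: "\<pi> permutes {- int n..int n}"
    and odd: "\<And>i. i \<in> {- int n..int n} \<Longrightarrow> \<pi> (- i) = - \<pi> i"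
    by (auto simp: hyperoctahedral_def)
  have "Hilbert_Choice.inv \<pi> (- i) = - Hilbert_Choice.inv \<pi> i" if "i \<in> {- int n..int n}" for i
  proof -
    have "Hilbert_Choice.inv \<pi> i \<in> {- int n..int n}"
      using permutes_in_image[OF permutes_inv[OF p]] that by blast
    then have "\<pi> (- Hilbert_Choice.inv \<pi> i) = - i"
      using odd permutes_inverses(1)[OF p] by simp
    then show ?thesis
      by (metis permutes_inverses(2)[OF p])
  qed
  then show "\<exists>\<tau>\<in>carrier (hyperoctahedral n). \<tau> \<otimes>\<^bsub>hyperoctahedral n\<^esub> \<pi> = \<one>\<^bsub>hyperoctahedral n\<^esub>"
    using permutes_inv[OF p] permutes_inv_o(2)[OF p]
    by (auto simp: hyperoctahedral_def intro!: bexI[of _ "Hilbert_Choice.inv \<pi>"])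
next
  fix \<sigma> \<tau>
  assume s: "\<sigma> \<in> carrier (hyperoctahedral n)" and t: "\<tau> \<in> carrier (hyperoctahedral n)"
  have "\<tau> i \<in> {- int n..int n}" if "i \<in> {- int n..int n}" for i
    using t that permutes_in_image unfolding hyperoctahedral_def by fastforce
  then show "\<sigma> \<otimes>\<^bsub>hyperoctahedral n\<^esub> \<tau> \<in> carrier (hyperoctahedral n)"
    using s t by (auto simp: hyperoctahedral_def intro: permutes_compose)
qed (auto simp: hyperoctahedral_def permutes_id comp_assoc)

lemma zeta_closed: "zeta n x \<in> carrier (group_algebra (hyperoctahedral n))"
proof -
  have "finite (carrier (hyperoctahedral n))"
    by (rule finite_subset[OF _ finite_permutations[of "{- int n..int n}"]])
       (auto simp: hyperoctahedral_def)
  moreover have "{\<pi>. zeta n x \<pi> \<noteq> 0} \<subseteq> carrier (hyperoctahedral n)"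
    by (auto simp: zeta_def)
  ultimately show ?thesis
    by (auto simp: group_algebra_def intro: finite_subset)
qed

end

theory Submission
  imports Defs "HOL-Computational_Algebra.Polynomial"
begin

text \<open>
  For \<open>x \<ge> 1\<close>, the coefficient of \<open>\<pi>\<close> in \<open>\<zeta>(x)\<close> counts shuffles: cut a deck of \<open>n\<close> cards into
  \<open>x\<close> piles labelled \<open>1 - x, \<dots>, 0\<close>, flip the piles with odd label (which negates their cards), and
  stack them by label. A word assigns its label to each card; each word has exactly one
  resulting signed permutation. Performing an \<open>x\<close>-shuffle and a \<open>y\<close>-shuffle amounts to a single
  \<open>xy\<close>-shuffle, whose label is the two-digit number formed from the two labels, where the lower digit is
  reflected inside the flipped piles. This is a bijection on words, which proves the identity
  for positive \<open>x\<close> and \<open>y\<close>. On each residue class modulo 2 both sides are polynomial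
  in \<open>x\<close> and in \<open>y\<close>, so the identity extends to all integers.
\<close>

section \<open>Enumerations of finite sets of integers\<close>

lemma strict_mono_on_int_iff_step:
  fixes e :: "int \<Rightarrow> 'a::order"
  shows "strict_mono_on {a..b} e \<longleftrightarrow> (\<forall>i\<in>{a..<b}. e i < e (i + 1))"
proof
  assume "strict_mono_on {a..b} e"
  then show "\<forall>i\<in>{a..<b}. e i < e (i + 1)"
    by (auto intro: strict_mono_onD)
next
  assume step: "\<forall>i\<in>{a..<b}. e i < e (i + 1)"
  have "e i < e j" if "a \<le> i" "i < j" "j \<le> b" for i j
  proof -
    have "i + 1 \<le> j" using that by simp
    then show ?thesis using that(1,3)
    proof (induction j rule: int_ge_induct)
      case base
      then show ?case using step by simp
    next
      case (step k)
      then have "e i < e k" by simp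
      also have "e k < e (k + 1)"
        using step \<open>\<forall>i\<in>{a..<b}. e i < e (i + 1)\<close> by simp
      finally show ?case .
    qed
  qed
  then show "strict_mono_on {a..b} e"
    by (auto intro!: strict_mono_onI)
qed

lemma ex_strict_mono_enumeration:
  fixes B :: "'a::linorder set"
  assumes "finite B" "card B = n"
  obtains e where "bij_betw e {1..int n} B" "strict_mono_on {1..int n} e"
proof
  let ?xs = "sorted_list_of_set B"
  let ?e = "\<lambda>i. ?xs ! nat (i - 1)"
  have len: "length ?xs = n" using assms by simp
  have shift: "bij_betw (\<lambda>i. nat (i - 1)) {1..int n} {..<n}"
    by (rule bij_betw_byWitness[where f' = "\<lambda>k. int k + 1"]) auto
  have "bij_betw ((!) ?xs) {..<n} B"
    using assms len by (intro bij_betw_nth) auto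
  from bij_betw_trans[OF shift this] show "bij_betw ?e {1..int n} B"
    by (simp add: comp_def)
  show "strict_mono_on {1..int n} ?e"
  proof (rule strict_mono_onI)
    fix i j assume "i \<in> {1..int n}" "j \<in> {1..int n}" "i < j"
    then have "nat (i - 1) < nat (j - 1)" "nat (j - 1) < length ?xs" using len by auto
    then show "?e i < ?e j"
      using sorted_wrt_nth_less[OF strict_sorted_list_of_set[of B]] by blast
  qed
qed

text \<open>Listed along \<open>[a..b]\<close>, both functions give the strictly sorted list of the
  same set.\<close>

lemma strict_mono_on_unique:
  fixes e e' :: "int \<Rightarrow> 'a::linorder"
  assumes e: "strict_mono_on {a..b} e" and e': "strict_mono_on {a..b} e'"
    and img: "e ` {a..b} = e' ` {a..b}" and i: "i \<in> {a..b}"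
  shows "e i = e' i"
proof -
  have sorted: "sorted_wrt (<) (map d [a..b])" if "strict_mono_on {a..b} d" for d :: "int \<Rightarrow> 'a"
    using that sorted_wrt_mono_rel[of "[a..b]" "(<)" "\<lambda>x y. d x < d y"]
    by (auto simp: sorted_wrt_map strict_mono_on_def)
  have "map e [a..b] = map e' [a..b]"
    using sorted[OF e] sorted[OF e'] img
    by (intro strict_sorted_equal) auto
  then show ?thesis using i by simp
qed

section \<open>The hyperoctahedral group\<close>

abbreviation hypB :: "nat \<Rightarrow> (int \<Rightarrow> int) set" where
  "hypB n \<equiv> carrier (hyperoctahedral n)"

lemma finite_hypB: "finite (hypB n)"
  by (rule finite_subset[OF _ finite_permutations[of "{- int n..int n}"]])
     (auto simp: hyperoctahedral_def)

lemma hypB_permutes: "\<pi> \<in> hypB n \<Longrightarrow> \<pi> permutes {- int n..int n}"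
  by (simp add: hyperoctahedral_def)

text \<open>Group elements fix everything outside the interval, so oddness holds at every integer
  and can later be used without a range check.\<close>

lemma hypB_minus:
  assumes "\<pi> \<in> hypB n" shows "\<pi> (- i) = - \<pi> i"
proof (cases "i \<in> {- int n..int n}")
  case True
  then show ?thesis using assms by (simp add: hyperoctahedral_def)
next
  case False
  then have "- i \<notin> {- int n..int n}" by auto
  then show ?thesis using False permutes_not_in[OF hypB_permutes[OF assms]] by metis
qed

lemma hypB_zero: "\<pi> \<in> hypB n \<Longrightarrow> \<pi> 0 = 0"
  using hypB_minus[of \<pi> n 0] by simp

lemma hypB_abs: "\<pi> \<in> hypB n \<Longrightarrow> \<bar>\<pi> \<bar>k\<bar>\<bar> = \<bar>\<pi> k\<bar>"
  using hypB_minus[of \<pi> n k] by (cases "k \<ge> 0") auto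

lemma hypB_comp: "\<sigma> \<in> hypB n \<Longrightarrow> \<tau> \<in> hypB n \<Longrightarrow> \<sigma> \<circ> \<tau> \<in> hypB n"
  using group.is_monoid[OF group_hyperoctahedral, of n] monoid.m_closed[of "hyperoctahedral n" \<sigma> \<tau>]
  by (simp add: hyperoctahedral_def)

lemma hypB_inv:
  assumes "\<pi> \<in> hypB n" shows "inv\<^bsub>hyperoctahedral n\<^esub> \<pi> \<in> hypB n"
    "(inv\<^bsub>hyperoctahedral n\<^esub> \<pi>) (\<pi> k) = k" "\<pi> ((inv\<^bsub>hyperoctahedral n\<^esub> \<pi>) k) = k"
proof -
  interpret group "hyperoctahedral n" by (rule group_hyperoctahedral)
  show "inv\<^bsub>hyperoctahedral n\<^esub> \<pi> \<in> hypB n" using assms by simp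
  show "(inv\<^bsub>hyperoctahedral n\<^esub> \<pi>) (\<pi> k) = k"
    using l_inv[OF assms] by (simp add: hyperoctahedral_def fun_eq_iff)
  show "\<pi> ((inv\<^bsub>hyperoctahedral n\<^esub> \<pi>) k) = k"
    using r_inv[OF assms] by (simp add: hyperoctahedral_def fun_eq_iff)
qed

lemma hypB_nonzero: "\<pi> \<in> hypB n \<Longrightarrow> \<pi> i = 0 \<longleftrightarrow> i = 0"
  by (metis hypB_inv(2) hypB_zero)

lemma hypB_abs_in:
  assumes "\<pi> \<in> hypB n" "i \<in> {1..int n}" shows "\<bar>\<pi> i\<bar> \<in> {1..int n}"
proof -
  have "\<pi> i \<in> {- int n..int n}"
    using assms permutes_in_image[OF hypB_permutes[OF assms(1)], of i] by simp
  moreover have "\<pi> i \<noteq> 0" using hypB_nonzero[OF assms(1)] assms(2) by auto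
  ultimately show ?thesis by auto
qed

text \<open>By oddness \<open>\<bar>\<pi> k\<bar>\<close> depends only on
  \<open>\<bar>k\<bar>\<close>. Forgetting signs therefore turns \<pi> into a permutation of
  \<open>{1..int n}\<close>, and the unsigned group inverse inverts it.\<close>

lemma hypB_abs_inv:
  assumes "\<pi> \<in> hypB n"
  shows "\<bar>(inv\<^bsub>hyperoctahedral n\<^esub> \<pi>) \<bar>\<pi> k\<bar>\<bar> = \<bar>k\<bar>" "\<bar>\<pi> \<bar>(inv\<^bsub>hyperoctahedral n\<^esub> \<pi>) k\<bar>\<bar> = \<bar>k\<bar>"
  using hypB_abs hypB_inv assms by metis+

lemma hypB_abs_image:
  assumes "\<pi> \<in> hypB n" shows "(\<lambda>i. \<bar>\<pi> i\<bar>) ` {1..int n} = {1..int n}"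
proof
  show "{1..int n} \<subseteq> (\<lambda>i. \<bar>\<pi> i\<bar>) ` {1..int n}"
  proof
    fix j assume j: "j \<in> {1..int n}"
    then have "\<bar>(inv\<^bsub>hyperoctahedral n\<^esub> \<pi>) j\<bar> \<in> {1..int n}"
      using hypB_abs_in hypB_inv(1) assms by blast
    moreover have "\<bar>\<pi> \<bar>(inv\<^bsub>hyperoctahedral n\<^esub> \<pi>) j\<bar>\<bar> = j"
      using hypB_abs_inv(2)[OF assms, of j] j by simp
    ultimately show "j \<in> (\<lambda>i. \<bar>\<pi> i\<bar>) ` {1..int n}" by (metis image_eqI)
  qed
qed (use hypB_abs_in assms in blast)

lemma hypB_eqI:
  assumes "\<pi> \<in> hypB n" "\<pi>' \<in> hypB n" "\<And>i. i \<in> {1..int n} \<Longrightarrow> \<pi> i = \<pi>' i"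
  shows "\<pi> = \<pi>'"
proof
  fix i
  consider "i \<in> {1..int n}" | "- i \<in> {1..int n}" | "i = 0" | "i \<notin> {- int n..int n}" by force
  then show "\<pi> i = \<pi>' i"
  proof cases
    case 2
    then show ?thesis
      using assms(3)[of "- i"] hypB_minus[OF assms(1)] hypB_minus[OF assms(2)] by simp
  next
    case 4
    then show ?thesis
      using permutes_not_in[OF hypB_permutes[OF assms(1)]] permutes_not_in[OF hypB_permutes[OF assms(2)]] by simp
  qed (use assms(3) hypB_zero[OF assms(1)] hypB_zero[OF assms(2)] in auto)
qed

text \<open>The witness is the odd extension of \<open>p\<close>, fixing 0 and everything outside
  the interval. It lets signed permutations be built from their values at positive
  positions.\<close>

lemma hypB_ex_extension:
  assumes inj: "inj_on (\<lambda>i. \<bar>p i\<bar>) {1..int n}" and rng: "\<And>i. i \<in> {1..int n} \<Longrightarrow> \<bar>p i\<bar> \<in> {1..int n}"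
  shows "\<exists>\<pi>\<in>hypB n. \<forall>i\<in>{1..int n}. \<pi> i = p i"
proof -
  define \<pi> where "\<pi> i = (if i \<in> {1..int n} then p i else if - i \<in> {1..int n} then - p (- i) else i)" for i
  have minus: "\<pi> (- i) = - \<pi> i" for i
    by (auto simp: \<pi>_def)
  have abs_\<pi>: "\<bar>\<pi> i\<bar> = \<bar>\<pi> \<bar>i\<bar>\<bar>" for i
    using minus[of i] by (cases "i \<ge> 0") auto
  have maps: "\<pi> ` {- int n..int n} \<subseteq> {- int n..int n}"
  proof safe
    fix i assume i: "i \<in> {- int n..int n}"
    show "\<pi> i \<in> {- int n..int n}"
      using rng[of i] rng[of "- i"] i by (force simp: \<pi>_def)
  qed
  have "inj_on \<pi> {- int n..int n}"
  proof (rule inj_onI)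
    fix i j assume ij: "i \<in> {- int n..int n}" "j \<in> {- int n..int n}" "\<pi> i = \<pi> j"
    have *: "\<pi> k = 0 \<longleftrightarrow> k = 0" if "k \<in> {- int n..int n}" for k
      using rng[of k] rng[of "- k"] that by (auto simp: \<pi>_def)
    show "i = j"
    proof (cases "i = 0 \<or> j = 0")
      case True
      then show ?thesis using * ij by metis
    next
      case False
      then have "\<bar>i\<bar> \<in> {1..int n}" "\<bar>j\<bar> \<in> {1..int n}" using ij by auto
      moreover have "\<bar>\<pi> \<bar>i\<bar>\<bar> = \<bar>\<pi> \<bar>j\<bar>\<bar>" using abs_\<pi> ij by metis
      ultimately have "\<bar>i\<bar> = \<bar>j\<bar>" using inj by (auto simp: \<pi>_def inj_on_def)
      \<comment> \<open>If \<open>i = - j\<close>, the common value of \<pi> would equal its own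
        negative, hence be 0, which happens only at 0.\<close>
      moreover have "i \<noteq> - j"
        using minus[of j] ij * False by fastforce
      ultimately show ?thesis by linarith
    qed
  qed
  then have "bij_betw \<pi> {- int n..int n} {- int n..int n}"
    using maps by (simp add: bij_betw_def endo_inj_surj)
  moreover have "\<pi> i = i" if "i \<notin> {- int n..int n}" for i
    using that by (auto simp: \<pi>_def)
  ultimately have "\<pi> permutes {- int n..int n}"
    by (rule bij_imp_permutes)
  then have "\<pi> \<in> hypB n" using minus by (simp add: hyperoctahedral_def)
  then show ?thesis by (auto simp: \<pi>_def intro!: bexI[of _ \<pi>])
qed

section \<open>Words\<close>

text \<open>Encodes the lexicographic order on pairs \<open>(a, s)\<close> with \<open>\<bar>s\<bar> \<le> n\<close> in one integer.\<close>

definition card_key :: "nat \<Rightarrow> int \<Rightarrow> int \<Rightarrow> int" where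
  "card_key n a s = a * (2 * int n + 1) + s"

text \<open>Two second components differ by at most \<open>2 * int n\<close>, less than the
  multiplier, so they matter only when the first components agree.\<close>

lemma card_key_less_iff:
  assumes "\<bar>s\<bar> \<le> int n" "\<bar>t\<bar> \<le> int n"
  shows "card_key n a s < card_key n b t \<longleftrightarrow> a < b \<or> a = b \<and> s < t"
proof -
  have *: "card_key n a s < card_key n b t"
    if "a < b" "\<bar>s\<bar> \<le> int n" "\<bar>t\<bar> \<le> int n" for a b s t
  proof -
    have "(a + 1) * (2 * int n + 1) \<le> b * (2 * int n + 1)"
      using that by (intro mult_right_mono) auto
    then show ?thesis using that by (simp add: card_key_def algebra_simps)
  qed
  show ?thesis
    using *[of a b s t] *[of b a t s] assms by (cases a b rule: linorder_cases) (auto simp: card_key_def)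
qed

lemma card_key_eq_iff:
  assumes "\<bar>s\<bar> \<le> int n" "\<bar>t\<bar> \<le> int n"
  shows "card_key n a s = card_key n b t \<longleftrightarrow> a = b \<and> s = t"
  using card_key_less_iff[OF assms, of a b] card_key_less_iff[OF assms(2,1), of b a] by force

text \<open>
  \<open>\<pi>\<close> is the result of the shuffle \<open>w\<close>: card \<open>\<bar>\<pi> i\<bar>\<close> ends up at position \<open>i\<close>, and \<open>\<pi> i < 0\<close> says
  that it was flipped.
\<close>

definition compat :: "nat \<Rightarrow> (int \<Rightarrow> int) \<Rightarrow> (int \<Rightarrow> int) \<Rightarrow> bool" where
  "compat n w \<pi> \<longleftrightarrow> \<pi> \<in> hypB n \<and> (\<forall>i\<in>{1..int n}. \<pi> i < 0 \<longleftrightarrow> odd (w \<bar>\<pi> i\<bar>)) \<and>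
     strict_mono_on {1..int n} (\<lambda>i. card_key n (w \<bar>\<pi> i\<bar>) (\<pi> i))"

lemma compat_signed:
  assumes "compat n w \<pi>" "i \<in> {1..int n}"
  shows "\<pi> i = (if odd (w \<bar>\<pi> i\<bar>) then - \<bar>\<pi> i\<bar> else \<bar>\<pi> i\<bar>)"
proof -
  have "\<pi> i < 0 \<longleftrightarrow> odd (w \<bar>\<pi> i\<bar>)" using assms by (simp add: compat_def)
  then show ?thesis by (cases "\<pi> i < 0") auto
qed

lemma compat_less:
  assumes "compat n w \<pi>" "i \<in> {1..int n}" "j \<in> {1..int n}" "i < j"
  shows "w \<bar>\<pi> i\<bar> < w \<bar>\<pi> j\<bar> \<or> w \<bar>\<pi> i\<bar> = w \<bar>\<pi> j\<bar> \<and> \<pi> i < \<pi> j"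
proof -
  have \<pi>: "\<pi> \<in> hypB n" using assms(1) by (simp add: compat_def)
  have "card_key n (w \<bar>\<pi> i\<bar>) (\<pi> i) < card_key n (w \<bar>\<pi> j\<bar>) (\<pi> j)"
    using assms by (simp add: compat_def strict_mono_on_def)
  then show ?thesis
    using card_key_less_iff[of "\<pi> i" n "\<pi> j"] hypB_abs_in[OF \<pi>] assms(2,3) by simp
qed

text \<open>The parity of its label forces the sign of each card, so \<open>w\<close> alone
  determines the keys \<open>K j\<close>, and these are distinct. A compatible \<pi> must list the
  cards by increasing key, which can be done in exactly one way.\<close>

lemma compat_ex1: "\<exists>!\<pi>. compat n w \<pi>"
proof -
  define s where "s j = (if odd (w j) then - j else j)" for j
  define K where "K j = card_key n (w j) (s j)" for j
  have s_abs: "\<bar>s j\<bar> = \<bar>j\<bar>" for j by (simp add: s_def)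
  have K_inj: "inj_on K {1..int n}"
  proof (rule inj_onI)
    fix i j assume ij: "i \<in> {1..int n}" "j \<in> {1..int n}" "K i = K j"
    then have "s i = s j" using card_key_eq_iff s_abs by (simp add: K_def)
    then have "\<bar>i\<bar> = \<bar>j\<bar>" using s_abs by metis
    then show "i = j" using ij by simp
  qed
  have compat_K: "K \<bar>\<pi> i\<bar> = card_key n (w \<bar>\<pi> i\<bar>) (\<pi> i)" if "compat n w \<pi>" "i \<in> {1..int n}" for \<pi> i
    using compat_signed[OF that] by (simp add: K_def s_def)
  show ?thesis
  proof (rule ex_ex1I)
    have "card (K ` {1..int n}) = n" using card_image[OF K_inj] by simp
    then obtain e where e: "bij_betw e {1..int n} (K ` {1..int n})" "strict_mono_on {1..int n} e"
      using ex_strict_mono_enumeration[of "K ` {1..int n}" n] by auto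
    \<comment> \<open>\<open>p i\<close> is the card with the \<open>i\<close>-th smallest key; its
      sign \<open>s\<close> is attached afterwards.\<close>
    define p where "p i = inv_into {1..int n} K (e i)" for i
    have e_in: "e i \<in> K ` {1..int n}" if "i \<in> {1..int n}" for i
      using that e(1) by (auto simp: bij_betw_def)
    have p: "p i \<in> {1..int n}" "K (p i) = e i" if "i \<in> {1..int n}" for i
      using inv_into_into[OF e_in[OF that]] f_inv_into_f[OF e_in[OF that]] by (auto simp: p_def)
    have "inj_on p {1..int n}"
    proof (rule inj_onI)
      fix i j assume ij: "i \<in> {1..int n}" "j \<in> {1..int n}" "p i = p j"
      then have "e i = e j" using p(2)[OF ij(1)] p(2)[OF ij(2)] by simp
      then show "i = j" using e(1) ij(1,2) unfolding bij_betw_def by (meson inj_onD)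
    qed
    then have "inj_on (\<lambda>i. \<bar>s (p i)\<bar>) {1..int n}"
    proof (rule inj_on_cong[THEN iffD2, rotated])
      show "\<bar>s (p i)\<bar> = p i" if "i \<in> {1..int n}" for i
        using p(1)[OF that] by (simp add: s_abs)
    qed
    moreover have "\<bar>s (p i)\<bar> \<in> {1..int n}" if "i \<in> {1..int n}" for i
      using p(1)[OF that] by (simp add: s_abs)
    ultimately obtain \<pi> where \<pi>: "\<pi> \<in> hypB n" "\<And>i. i \<in> {1..int n} \<Longrightarrow> \<pi> i = s (p i)"
      using hypB_ex_extension[of "\<lambda>i. s (p i)" n] by blast
    have *: "\<bar>\<pi> i\<bar> = p i" if "i \<in> {1..int n}" for i
      using \<pi>(2)[OF that] p(1)[OF that] by (simp add: s_abs)
    have "compat n w \<pi>"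
      unfolding compat_def
    proof (intro conjI ballI)
      fix i assume i: "i \<in> {1..int n}"
      show "\<pi> i < 0 \<longleftrightarrow> odd (w \<bar>\<pi> i\<bar>)"
        using \<pi>(2)[OF i] p(1)[OF i] *[OF i] by (simp add: s_def)
    next
      show "strict_mono_on {1..int n} (\<lambda>i. card_key n (w \<bar>\<pi> i\<bar>) (\<pi> i))"
        using e(2) p(2) \<pi>(2) * by (simp add: strict_mono_on_def K_def)
    qed (fact \<pi>(1))
    then show "\<exists>\<pi>. compat n w \<pi>" by blast
  next
    fix \<pi> \<pi>' assume c: "compat n w \<pi>" "compat n w \<pi>'"
    \<comment> \<open>Along any compatible \<rho> the keys form an increasing enumeration of the
      same set, so two such sequences agree.\<close>
    have mono: "strict_mono_on {1..int n} (\<lambda>i. K \<bar>\<rho> i\<bar>)"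
      and img: "(\<lambda>i. K \<bar>\<rho> i\<bar>) ` {1..int n} = K ` {1..int n}" if "compat n w \<rho>" for \<rho>
    proof -
      show "strict_mono_on {1..int n} (\<lambda>i. K \<bar>\<rho> i\<bar>)"
        using that compat_K[OF that] by (simp add: compat_def strict_mono_on_def)
      show "(\<lambda>i. K \<bar>\<rho> i\<bar>) ` {1..int n} = K ` {1..int n}"
        using hypB_abs_image[of \<rho> n] that image_image[of K "\<lambda>i. \<bar>\<rho> i\<bar>" "{1..int n}"]
        by (simp add: compat_def)
    qed
    show "\<pi> = \<pi>'"
    proof (rule hypB_eqI)
      fix i assume i: "i \<in> {1..int n}"
      have "K \<bar>\<pi> i\<bar> = K \<bar>\<pi>' i\<bar>"
        using strict_mono_on_unique[OF mono[OF c(1)] mono[OF c(2)] _ i] img[OF c(1)] img[OF c(2)] by simp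
      moreover have "\<bar>\<pi> i\<bar> \<in> {1..int n}" "\<bar>\<pi>' i\<bar> \<in> {1..int n}"
        using c i hypB_abs_in by (auto simp only: compat_def)
      ultimately have "\<bar>\<pi> i\<bar> = \<bar>\<pi>' i\<bar>"
        by (rule inj_onD[OF K_inj])
      then show "\<pi> i = \<pi>' i"
        using compat_signed[OF c(1) i] compat_signed[OF c(2) i] by metis
    qed (use c in \<open>simp_all add: compat_def\<close>)
  qed
qed

text \<open>The signed version of the standardization of a word: cards are sorted by label, parity
  gives the signs, and ties are broken by signed value.\<close>

definition std :: "nat \<Rightarrow> (int \<Rightarrow> int) \<Rightarrow> int \<Rightarrow> int" where
  "std n w = (THE \<pi>. compat n w \<pi>)"

lemma compat_std: "compat n w (std n w)"
  unfolding std_def by (rule theI'[OF compat_ex1])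

lemma compat_iff_std: "compat n w \<pi> \<longleftrightarrow> std n w = \<pi>"
  using compat_ex1 compat_std by metis

lemma std_in: "std n w \<in> hypB n"
  using compat_std by (simp add: compat_def)

text \<open>The range ends at the even label 0, so the last pile is never flipped; this matches the
  extra descent that \<open>des_B\<close> counts when \<pi> starts with a negative value.\<close>

definition words :: "nat \<Rightarrow> int \<Rightarrow> (int \<Rightarrow> int) set" where
  "words n x = {1..int n} \<rightarrow>\<^sub>E {1 - x..0}"

lemma finite_words: "finite (words n x)"
  by (simp add: words_def finite_PiE)

lemma card_words: "card (words n x) = nat x ^ n"
  by (simp add: words_def card_PiE)

lemma words_in: "w \<in> words n x \<Longrightarrow> j \<in> {1..int n} \<Longrightarrow> w j \<in> {1 - x..0}"
  unfolding words_def by (rule PiE_mem)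

section \<open>Composition of words\<close>

text \<open>Digit \<open>a\<close> ranges over \<open>{1 - x..0}\<close>, on which \<open>1 - x - a\<close> is the reflection.\<close>

definition snake :: "int \<Rightarrow> int \<Rightarrow> int \<Rightarrow> int" where
  "snake x b a = x * b + (if even b then a else 1 - x - a)"

text \<open>For odd \<open>b\<close> the value is \<open>x * (b - 1) + 1 - a\<close>, where the
  product is even. Thus a card is flipped overall iff exactly one of the two shuffles flips
  it.\<close>

lemma odd_snake: "odd (snake x b a) \<longleftrightarrow> odd a \<noteq> odd b"
  by (auto simp: snake_def)

text \<open>The values with leading digit \<open>b\<close> lie in the block from
  \<open>x * b - x + 1\<close> to \<open>x * b\<close>. Blocks of different digits are disjoint and
  ordered, and the reflection reverses the order inside odd blocks.\<close>

lemma snake_less_iff: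
  assumes "a \<in> {1 - x..0}" "a' \<in> {1 - x..0}"
  shows "snake x b a < snake x b' a' \<longleftrightarrow> b < b' \<or> b = b' \<and> (if even b then a < a' else a' < a)"
proof -
  have *: "snake x b a < snake x b' a'"
    if "b < b'" "a \<in> {1 - x..0}" "a' \<in> {1 - x..0}" for b b' a a'
  proof -
    have "x * (b + 1) \<le> x * b'"
      using that by (intro mult_left_mono) auto
    moreover have "snake x b a \<le> x * b" "x * b' - x < snake x b' a'"
      using that by (auto simp: snake_def)
    ultimately show ?thesis by (simp add: algebra_simps)
  qed
  show ?thesis
    using *[of b b' a a'] *[of b' b a' a] assms
    by (cases b b' rule: linorder_cases) (auto simp: snake_def)
qed

lemma snake_eq_iff:
  assumes "a \<in> {1 - x..0}" "a' \<in> {1 - x..0}"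
  shows "snake x b a = snake x b' a' \<longleftrightarrow> b = b' \<and> a = a'"
  using snake_less_iff[OF assms, of b b'] snake_less_iff[OF assms(2,1), of b' b]
  by (cases b b' rule: linorder_cases) (auto simp: snake_def)

lemma snake_in:
  assumes "a \<in> {1 - x..0}" "b \<in> {1 - y..0}"
  shows "snake x b a \<in> {1 - x * y..0}"
proof -
  have "x \<ge> 0" using assms(1) by simp
  then have "x * (1 - y) \<le> x * b" "x * b \<le> 0"
    using assms(2) by (simp_all add: mult_left_mono mult_nonneg_nonpos)
  moreover have "snake x b a \<le> x * b" "x * b - x < snake x b a"
    using assms by (auto simp: snake_def)
  ultimately show ?thesis by (simp add: algebra_simps)
qed

text \<open>After the shuffle \<open>f\<close>, card \<open>j\<close> sits at the position given by
  the unsigned inverse of \<open>std n f\<close>. The second shuffle \<open>g\<close> labels that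
  position, which supplies the leading digit.\<close>

definition comp_word :: "nat \<Rightarrow> int \<Rightarrow> (int \<Rightarrow> int) \<Rightarrow> (int \<Rightarrow> int) \<Rightarrow> int \<Rightarrow> int" where
  "comp_word n x f g =
     restrict (\<lambda>j. snake x (g \<bar>(inv\<^bsub>hyperoctahedral n\<^esub> (std n f)) j\<bar>) (f j)) {1..int n}"

lemma comp_word_in:
  assumes "f \<in> words n x" "g \<in> words n y"
  shows "comp_word n x f g \<in> words n (x * y)"
proof -
  have "snake x (g \<bar>(inv\<^bsub>hyperoctahedral n\<^esub> (std n f)) j\<bar>) (f j) \<in> {1 - x * y..0}"
    if j: "j \<in> {1..int n}" for j
    using snake_in words_in[OF assms(1) j]
      words_in[OF assms(2) hypB_abs_in[OF hypB_inv(1)[OF std_in] j]] by blast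
  then show ?thesis by (auto simp: words_def comp_word_def)
qed

text \<open>The lower digits recover \<open>f\<close>, hence \<open>std n f\<close>; undoing this
  permutation in the leading digits recovers \<open>g\<close>.\<close>

lemma inj_on_comp_word:
  "inj_on (\<lambda>(f, g). comp_word n x f g) (words n x \<times> words n y)"
proof (rule inj_onI, clarify)
  fix f g f' g'
  assume w: "f \<in> words n x" "g \<in> words n y" "f' \<in> words n x" "g' \<in> words n y"
    and eq: "comp_word n x f g = comp_word n x f' g'"
  have *: "g \<bar>(inv\<^bsub>hyperoctahedral n\<^esub> (std n f)) j\<bar> = g' \<bar>(inv\<^bsub>hyperoctahedral n\<^esub> (std n f')) j\<bar> \<and> f j = f' j"
    if j: "j \<in> {1..int n}" for j
    using fun_cong[OF eq, of j] j snake_eq_iff words_in[OF w(1) j] words_in[OF w(3) j]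
    by (simp add: comp_word_def)
  then have f: "f = f'"
    using w(1,3) unfolding words_def by (intro PiE_ext) auto
  have "g k = g' k" if k: "k \<in> {1..int n}" for k
  proof -
    have "\<bar>(inv\<^bsub>hyperoctahedral n\<^esub> (std n f)) \<bar>std n f k\<bar>\<bar> = k"
      using hypB_abs_inv(1)[OF std_in] k by simp
    then show ?thesis using *[OF hypB_abs_in[OF std_in k, of f]] f by simp
  qed
  then have "g = g'"
    using w(2,4) unfolding words_def by (intro PiE_ext) auto
  with f show "f = f' \<and> g = g'" by simp
qed

text \<open>Surjectivity follows by counting. The assumption on \<open>x\<close> makes
  \<open>nat\<close> multiplicative on \<open>x * y\<close>.\<close>

lemma bij_betw_comp_word:
  assumes "x \<ge> 0"
  shows "bij_betw (\<lambda>(f, g). comp_word n x f g) (words n x \<times> words n y) (words n (x * y))"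
proof -
  have "card ((\<lambda>(f, g). comp_word n x f g) ` (words n x \<times> words n y)) = card (words n (x * y))"
    using assms by (simp add: card_image[OF inj_on_comp_word] card_cartesian_product card_words
        nat_mult_distrib power_mult_distrib)
  then have "(\<lambda>(f, g). comp_word n x f g) ` (words n x \<times> words n y) = words n (x * y)"
    using comp_word_in by (intro card_subset_eq finite_words) auto
  then show ?thesis using inj_on_comp_word by (simp add: bij_betw_def)
qed

text \<open>By uniqueness it suffices that the composite is compatible with the combined word. Signs
  multiply as in \<open>odd_snake\<close>; the order is decided by \<open>g\<close>, and within a
  pile of \<open>g\<close> by \<open>f\<close>.\<close>

lemma std_comp_word:
  assumes f: "f \<in> words n x"
  shows "std n (comp_word n x f g) = std n f \<circ> std n g"
proof -
  define \<sigma> \<tau> where "\<sigma> = std n f" and "\<tau> = std n g"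
  have \<sigma>: "\<sigma> \<in> hypB n" and \<tau>: "\<tau> \<in> hypB n" by (simp_all add: \<sigma>_def \<tau>_def std_in)
  have cf: "compat n f \<sigma>" and cg: "compat n g \<tau>" by (simp_all add: \<sigma>_def \<tau>_def compat_std)
  define a b where "a i = f \<bar>\<sigma> (\<tau> i)\<bar>" and "b i = g \<bar>\<tau> i\<bar>" for i
  have \<sigma>\<tau>: "\<bar>\<sigma> (\<tau> i)\<bar> \<in> {1..int n}" if "i \<in> {1..int n}" for i
    using hypB_abs_in[OF hypB_comp[OF \<sigma> \<tau>] that] by simp
  have a_in: "a i \<in> {1 - x..0}" if "i \<in> {1..int n}" for i
    unfolding a_def by (rule words_in[OF f \<sigma>\<tau>[OF that]])
  have h: "comp_word n x f g \<bar>\<sigma> (\<tau> i)\<bar> = snake x (b i) (a i)" if "i \<in> {1..int n}" for i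
  proof -
    have "\<bar>(inv\<^bsub>hyperoctahedral n\<^esub> \<sigma>) \<bar>\<sigma> (\<tau> i)\<bar>\<bar> = \<bar>\<tau> i\<bar>"
      using hypB_abs_inv(1)[OF \<sigma>] .
    then show ?thesis using \<sigma>\<tau>[OF that] by (simp add: comp_word_def a_def b_def \<sigma>_def[symmetric])
  qed
  have sg: "\<tau> i < 0 \<longleftrightarrow> odd (b i)" if "i \<in> {1..int n}" for i
    using cg that by (simp add: compat_def b_def)
  have sf: "\<sigma> (\<tau> i) < 0 \<longleftrightarrow> (\<tau> i < 0) \<noteq> odd (a i)" if i: "i \<in> {1..int n}" for i
  proof -
    have k: "\<bar>\<tau> i\<bar> \<in> {1..int n}" by (rule hypB_abs_in[OF \<tau> i])
    have "\<sigma> \<bar>\<tau> i\<bar> < 0 \<longleftrightarrow> odd (a i)"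
      using cf k hypB_abs[OF \<sigma>, of "\<tau> i"] by (simp add: compat_def a_def)
    moreover have "\<sigma> (\<tau> i) \<noteq> 0" "\<tau> i \<noteq> 0" using \<sigma>\<tau>[OF i] k by auto
    ultimately show ?thesis
      using hypB_minus[OF \<sigma>, of "\<tau> i"] by (cases "\<tau> i < 0") auto
  qed
  have mono_f: "f \<bar>\<sigma> k\<bar> < f \<bar>\<sigma> l\<bar> \<or> f \<bar>\<sigma> k\<bar> = f \<bar>\<sigma> l\<bar> \<and> \<sigma> k < \<sigma> l"
    if "k \<in> {1..int n}" "l \<in> {1..int n}" "k < l" for k l
    using compat_less[OF cf that] .
  have "compat n (comp_word n x f g) (\<sigma> \<circ> \<tau>)"
    unfolding compat_def
  proof (intro conjI ballI strict_mono_onI)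
    show "\<sigma> \<circ> \<tau> \<in> hypB n" by (rule hypB_comp[OF \<sigma> \<tau>])
  next
    fix i assume i: "i \<in> {1..int n}"
    show "(\<sigma> \<circ> \<tau>) i < 0 \<longleftrightarrow> odd (comp_word n x f g \<bar>(\<sigma> \<circ> \<tau>) i\<bar>)"
      using h[OF i] sg[OF i] sf[OF i] odd_snake by auto
  next
    fix i j assume i: "i \<in> {1..int n}" and j: "j \<in> {1..int n}" and "i < j"
    have bij: "b i < b j \<or> b i = b j \<and> \<tau> i < \<tau> j"
      using compat_less[OF cg i j \<open>i < j\<close>] by (simp add: b_def)
    have "snake x (b i) (a i) < snake x (b j) (a j) \<or>
      snake x (b i) (a i) = snake x (b j) (a j) \<and> \<sigma> (\<tau> i) < \<sigma> (\<tau> j)"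
    proof (cases "b i < b j")
      case True
      then show ?thesis using snake_less_iff[OF a_in[OF i] a_in[OF j]] by simp
    next
      case False
      then have b: "b i = b j" and less: "\<tau> i < \<tau> j" using bij by auto
      have k: "\<bar>\<tau> i\<bar> \<in> {1..int n}" "\<bar>\<tau> j\<bar> \<in> {1..int n}"
        using hypB_abs_in \<tau> i j by auto
      show ?thesis
      proof (cases "even (b i)")
        case True
        then have "\<bar>\<tau> i\<bar> = \<tau> i" "\<bar>\<tau> j\<bar> = \<tau> j" using sg[OF i] sg[OF j] b by auto
        then have "a i < a j \<or> a i = a j \<and> \<sigma> (\<tau> i) < \<sigma> (\<tau> j)"
          using mono_f[OF k] less by (simp add: a_def)
        then show ?thesis using snake_less_iff[OF a_in[OF i] a_in[OF j]] b True by auto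
      next
        \<comment> \<open>In a flipped pile of \<open>g\<close> the positions
          \<open>\<bar>\<tau> i\<bar>\<close> run backwards, so \<open>f\<close> compares the two
          cards in reverse. The reflected digit and the oddness of \<sigma> restore the
          order.\<close>
        case False
        then have "\<bar>\<tau> i\<bar> = - \<tau> i" "\<bar>\<tau> j\<bar> = - \<tau> j" using sg[OF i] sg[OF j] b by auto
        then have "a j < a i \<or> a j = a i \<and> \<sigma> (\<tau> i) < \<sigma> (\<tau> j)"
          using mono_f[OF k(2,1)] less hypB_minus[OF \<sigma>] by (simp add: a_def)
        then show ?thesis using snake_less_iff[OF a_in[OF i] a_in[OF j]] b False by auto
      qed
    qed
    then show "card_key n (comp_word n x f g \<bar>(\<sigma> \<circ> \<tau>) i\<bar>) ((\<sigma> \<circ> \<tau>) i) <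
      card_key n (comp_word n x f g \<bar>(\<sigma> \<circ> \<tau>) j\<bar>) ((\<sigma> \<circ> \<tau>) j)"
      using card_key_less_iff \<sigma>\<tau>[OF i] \<sigma>\<tau>[OF j] h[OF i] h[OF j] by auto
  qed
  then show ?thesis by (simp add: compat_iff_std \<sigma>_def \<tau>_def)
qed

definition word_count :: "nat \<Rightarrow> int \<Rightarrow> (int \<Rightarrow> int) \<Rightarrow> nat" where
  "word_count n x \<pi> = card {w \<in> words n x. std n w = \<pi>}"

text \<open>Words for \<open>x * y\<close> correspond to pairs of words, which are then grouped by
  the pair of their standardizations.\<close>

lemma word_count_mult:
  assumes "x \<ge> 0"
  shows "word_count n (x * y) \<pi> =
    (\<Sum>(\<sigma>, \<tau>) \<in> {(\<sigma>, \<tau>). \<sigma> \<in> hypB n \<and> \<tau> \<in> hypB n \<and> \<sigma> \<circ> \<tau> = \<pi>}. word_count n x \<sigma> * word_count n y \<tau>)"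
proof -
  let ?T = "{(\<sigma>, \<tau>). \<sigma> \<in> hypB n \<and> \<tau> \<in> hypB n \<and> \<sigma> \<circ> \<tau> = \<pi>}"
  let ?S = "{(f, g). f \<in> words n x \<and> g \<in> words n y \<and> std n f \<circ> std n g = \<pi>}"
  let ?k = "\<lambda>(f, g). (std n f, std n g)"
  have fS: "finite ?S"
    by (rule finite_subset[of _ "words n x \<times> words n y"]) (auto simp: finite_words)
  have fT: "finite ?T"
    by (rule finite_subset[of _ "hypB n \<times> hypB n"]) (auto simp: finite_hypB)
  have "bij_betw (\<lambda>(f, g). comp_word n x f g) ?S {w \<in> words n (x * y). std n w = \<pi>}"
  proof (rule bij_betw_subset[OF bij_betw_comp_word[OF assms, of n y]])
    show "(\<lambda>(f, g). comp_word n x f g) ` ?S = {w \<in> words n (x * y). std n w = \<pi>}"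
    proof safe
      fix w assume w: "w \<in> words n (x * y)" "\<pi> = std n w"
      have "w \<in> (\<lambda>(f, g). comp_word n x f g) ` (words n x \<times> words n y)"
        using w(1) bij_betw_imp_surj_on[OF bij_betw_comp_word[OF assms, of n y]] by simp
      then obtain f g where fg: "f \<in> words n x" "g \<in> words n y" "w = comp_word n x f g"
        by (elim imageE SigmaE) simp
      then show "w \<in> (\<lambda>(f, g). comp_word n x f g) `
          {(f, g). f \<in> words n x \<and> g \<in> words n y \<and> std n f \<circ> std n g = std n w}"
        using std_comp_word[OF fg(1)] by (auto intro!: image_eqI[of _ _ "(f, g)"])
    qed (auto simp: comp_word_in std_comp_word)
  qed auto
  then have "word_count n (x * y) \<pi> = card ?S"
    by (simp add: word_count_def bij_betw_same_card)
  also have "\<dots> = (\<Sum>t\<in>?T. card {s \<in> ?S. ?k s = t})"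
  proof -
    have "?k ` ?S \<subseteq> ?T" by (auto simp: std_in)
    from sum.group[OF fS fT this, of "\<lambda>_. 1::nat"] show ?thesis by simp
  qed
  also have "\<dots> = (\<Sum>(\<sigma>, \<tau>)\<in>?T. word_count n x \<sigma> * word_count n y \<tau>)"
  proof (rule sum.cong[OF refl], clarify)
    fix \<sigma> \<tau> :: "int \<Rightarrow> int" assume "\<pi> = \<sigma> \<circ> \<tau>"
    \<comment> \<open>Once both standardizations are prescribed, the condition on their product is
      automatic, so each fibre is a Cartesian product.\<close>
    have "{s. s \<in> {(f, g). f \<in> words n x \<and> g \<in> words n y \<and> std n f \<circ> std n g = \<sigma> \<circ> \<tau>} \<and> ?k s = (\<sigma>, \<tau>)}
      = {f \<in> words n x. std n f = \<sigma>} \<times> {g \<in> words n y. std n g = \<tau>}"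
      by auto
    then show "card {s \<in> {(f, g). f \<in> words n x \<and> g \<in> words n y \<and> std n f \<circ> std n g = \<sigma> \<circ> \<tau>}. ?k s = (\<sigma>, \<tau>)}
      = word_count n x \<sigma> * word_count n y \<tau>"
      by (simp add: word_count_def card_cartesian_product)
  qed
  finally show ?thesis .
qed

section \<open>Counting the words of a signed permutation\<close>

definition descents_upto :: "(int \<Rightarrow> int) \<Rightarrow> int \<Rightarrow> int" where
  "descents_upto \<pi> i = int (card {k \<in> {1..<i}. \<pi> k > \<pi> (k + 1)})"

lemma descents_upto_1: "descents_upto \<pi> 1 = 0"
  by (simp add: descents_upto_def)

lemma descents_upto_step:
  assumes "i \<ge> 1"
  shows "descents_upto \<pi> (i + 1) = descents_upto \<pi> i + (if \<pi> i > \<pi> (i + 1) then 1 else 0)"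
proof -
  let ?D = "{k \<in> {1..<i}. \<pi> k > \<pi> (k + 1)}"
  have "{k \<in> {1..<i + 1}. \<pi> k > \<pi> (k + 1)} = (if \<pi> i > \<pi> (i + 1) then insert i ?D else ?D)"
    using assms by (auto simp: order_le_less)
  moreover have "card (insert i ?D) = Suc (card ?D)"
    by (rule card_insert_disjoint) (simp_all del: atLeastLessThan_iff atLeastAtMost_iff add: atLeastLessThan_iff[of i])
  ultimately show ?thesis
    unfolding descents_upto_def by (cases "\<pi> i > \<pi> (i + 1)") (simp_all only: if_True if_False of_nat_Suc)
qed

lemma descents_upto_n: "descents_upto \<pi> (int n) = int (des_A n \<pi>)"
proof -
  have "{1..<int n} = {1..int n - 1}" by auto
  then show ?thesis by (simp add: descents_upto_def des_A_def)
qed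

text \<open>Since \<open>\<pi> 0 = 0\<close>, the only descent that \<open>des_B\<close> adds to
  \<open>des_A\<close> is the one at 0, present iff \<open>\<pi> 1 < 0\<close>.\<close>

lemma fdes_eq:
  assumes "n \<ge> 1" "\<pi> \<in> hypB n"
  shows "fdes n \<pi> = 2 * des_A n \<pi> + (if \<pi> 1 < 0 then 1 else 0)"
proof -
  let ?D = "{i \<in> {1..int n - 1}. \<pi> i > \<pi> (i + 1)}"
  have "{i \<in> {0..int n - 1}. \<pi> i > \<pi> (i + 1)} = (if \<pi> 1 < 0 then insert 0 ?D else ?D)"
    using assms hypB_zero[OF assms(2)] by (auto simp: order_le_less)
  moreover have "card (insert 0 ?D) = Suc (card ?D)"
    by (rule card_insert_disjoint) (simp_all del: atLeastLessThan_iff atLeastAtMost_iff add: atLeastAtMost_iff[of 0])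
  ultimately show ?thesis
    by (auto simp only: fdes_def des_A_def des_B_def split: if_split)
qed

text \<open>Halving merges the labels \<open>2 * k - 1\<close> and \<open>2 * k\<close>. Inside such
  a pair the odd label carries a negative value and the even one a positive value, so label order
  and value order agree and only descents force a larger half.\<close>

lemma less_or_ascent_iff_half:
  fixes u v s t :: int
  assumes "s \<noteq> t" "s < 0 \<longleftrightarrow> odd u" "t < 0 \<longleftrightarrow> odd v"
  shows "u < v \<or> u = v \<and> s < t \<longleftrightarrow> (u + 1) div 2 + (if s > t then 1 else 0) \<le> (v + 1) div 2"
proof (cases "s > t")
  case True
  then show ?thesis using assms by simp presburger
next
  case False
  then show ?thesis using assms by simp presburger
qed

text \<open>
  Halving the labels leaves a sequence that is weakly increasing, strictly so at the descents of
  \<open>\<pi>\<close>; the remaining terms make it strictly increasing everywhere. The lost parity is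
  recovered from the sign of \<open>\<pi> i\<close>, so words correspond to \<open>n\<close>-subsets of an interval.
\<close>

definition level :: "(int \<Rightarrow> int) \<Rightarrow> (int \<Rightarrow> int) \<Rightarrow> int \<Rightarrow> int" where
  "level \<pi> a i = (a i + 1) div 2 + i - descents_upto \<pi> i"

lemma level_step_iff:
  assumes \<pi>: "\<pi> \<in> hypB n" and i: "i \<in> {1..<int n}"
    and par: "\<And>i. i \<in> {1..int n} \<Longrightarrow> \<pi> i < 0 \<longleftrightarrow> odd (a i)"
  shows "card_key n (a i) (\<pi> i) < card_key n (a (i + 1)) (\<pi> (i + 1)) \<longleftrightarrow> level \<pi> a i < level \<pi> a (i + 1)"
proof -
  have i1: "i \<in> {1..int n}" "i + 1 \<in> {1..int n}" using i by auto
  have "card_key n (a i) (\<pi> i) < card_key n (a (i + 1)) (\<pi> (i + 1)) \<longleftrightarrow>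
    a i < a (i + 1) \<or> a i = a (i + 1) \<and> \<pi> i < \<pi> (i + 1)"
    using hypB_abs_in[OF \<pi> i1(1)] hypB_abs_in[OF \<pi> i1(2)] by (intro card_key_less_iff) auto
  also have "\<dots> \<longleftrightarrow> (a i + 1) div 2 + (if \<pi> i > \<pi> (i + 1) then 1 else 0) \<le> (a (i + 1) + 1) div 2"
  proof (rule less_or_ascent_iff_half[OF _ par[OF i1(1)] par[OF i1(2)]])
    show "\<pi> i \<noteq> \<pi> (i + 1)"
      using hypB_inv(2)[OF \<pi>] by (metis add_cancel_right_right zero_neq_one)
  qed
  \<comment> \<open>From \<open>i\<close> to \<open>i + 1\<close> the correction terms grow by 1 at
    an ascent and by 0 at a descent, which turns the inequality into a strict one in both
    cases.\<close>
  also have "\<dots> \<longleftrightarrow> level \<pi> a i < level \<pi> a (i + 1)"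
    using descents_upto_step[of i \<pi>] i by (auto simp: level_def)
  finally show ?thesis .
qed

lemma compat_iff_level:
  assumes \<pi>: "\<pi> \<in> hypB n" and par: "\<And>i. i \<in> {1..int n} \<Longrightarrow> \<pi> i < 0 \<longleftrightarrow> odd (w \<bar>\<pi> i\<bar>)"
  shows "compat n w \<pi> \<longleftrightarrow> strict_mono_on {1..int n} (level \<pi> (\<lambda>i. w \<bar>\<pi> i\<bar>))"
  using level_step_iff[OF \<pi> _ par] assms
  by (simp add: compat_def strict_mono_on_int_iff_step)

lemma compat_weakly_increasing:
  assumes "compat n w \<pi>" "i \<in> {1..int n}" "j \<in> {1..int n}" "i \<le> j"
  shows "w \<bar>\<pi> i\<bar> \<le> w \<bar>\<pi> j\<bar>"
  using compat_less[OF assms(1-3)] assms(4) by (cases "i = j") auto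

text \<open>Labels and levels both increase along \<pi>, so only the first and last positions need
  to be compared with the bounds.\<close>

lemma compat_words_iff:
  assumes c: "compat n w \<pi>" and n: "n \<ge> 1" and ext: "w \<in> extensional {1..int n}"
  shows "w \<in> words n x \<longleftrightarrow>
    level \<pi> (\<lambda>i. w \<bar>\<pi> i\<bar>) ` {1..int n} \<subseteq>
      {1 - (x - 1 - (if \<pi> 1 < 0 then 1 else 0)) div 2..int n - int (des_A n \<pi>)}"
    (is "_ \<longleftrightarrow> ?e ` _ \<subseteq> {?L..?U}")
proof -
  have \<pi>: "\<pi> \<in> hypB n" using c by (simp add: compat_def)
  have par: "\<pi> i < 0 \<longleftrightarrow> odd (w \<bar>\<pi> i\<bar>)" if "i \<in> {1..int n}" for i
    using c that by (simp add: compat_def)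
  have mono: "strict_mono_on {1..int n} ?e"
    using compat_iff_level[OF \<pi> par] c by simp
  have ends: "1 \<in> {1..int n}" "int n \<in> {1..int n}" using n by auto
  have low: "w \<bar>\<pi> 1\<bar> \<le> w \<bar>\<pi> i\<bar>" and high: "w \<bar>\<pi> i\<bar> \<le> w \<bar>\<pi> (int n)\<bar>" if "i \<in> {1..int n}" for i
    using compat_weakly_increasing[OF c ends(1) that] compat_weakly_increasing[OF c that ends(2)] that by auto
  have "w \<in> words n x \<longleftrightarrow> (\<forall>j\<in>{1..int n}. w j \<in> {1 - x..0})"
    using ext by (auto simp: words_def PiE_def)
  also have "\<dots> \<longleftrightarrow> (\<forall>i\<in>{1..int n}. w \<bar>\<pi> i\<bar> \<in> {1 - x..0})"
    by (subst hypB_abs_image[OF \<pi>, symmetric]) (simp only: ball_simps)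
  also have "\<dots> \<longleftrightarrow> 1 - x \<le> w \<bar>\<pi> 1\<bar> \<and> w \<bar>\<pi> (int n)\<bar> \<le> 0"
    using low high ends
    by (meson atLeastAtMost_iff order_trans)
  also have "\<dots> \<longleftrightarrow> ?L \<le> ?e 1 \<and> ?e (int n) \<le> ?U"
  proof -
    \<comment> \<open>The label at position 1 is twice its half, minus 1 if
      \<open>\<pi> 1 < 0\<close>; this is the source of the sign term in the lower bound. The upper
      bound has none, because 0 is even.\<close>
    have "1 - x \<le> w \<bar>\<pi> 1\<bar> \<longleftrightarrow> ?L \<le> ?e 1"
      using par[OF ends(1)] by (cases "\<pi> 1 < 0") (auto simp: level_def descents_upto_1; presburger)+
    moreover have "w \<bar>\<pi> (int n)\<bar> \<le> 0 \<longleftrightarrow> ?e (int n) \<le> ?U"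
      by (simp add: level_def descents_upto_n) presburger
    ultimately show ?thesis by simp
  qed
  also have "\<dots> \<longleftrightarrow> ?e ` {1..int n} \<subseteq> {?L..?U}"
  proof -
    have "?e 1 \<le> ?e i" "?e i \<le> ?e (int n)" if "i \<in> {1..int n}" for i
      using strict_mono_on_leD[OF mono] that ends by auto
    then show ?thesis using ends unfolding image_subset_iff
      by (meson atLeastAtMost_iff order_trans)
  qed
  finally show ?thesis .
qed

text \<open>A word is determined by the set of its levels, and every \<open>n\<close>-subset of the
  interval \<open>?A\<close> occurs; the upper index is the size of \<open>?A\<close>.\<close>

lemma word_count_eq_binomial:
  assumes \<pi>: "\<pi> \<in> hypB n" and n: "n \<ge> 1"
  shows "word_count n x \<pi> =
    nat (int n - int (des_A n \<pi>) + (x - 1 - (if \<pi> 1 < 0 then 1 else 0)) div 2) choose n"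
proof -
  let ?I = "{1..int n}"
  let ?A = "{1 - (x - 1 - (if \<pi> 1 < 0 then 1 else 0)) div 2..int n - int (des_A n \<pi>)}"
  let ?W = "{w \<in> words n x. std n w = \<pi>}"
  let ?e = "\<lambda>w. level \<pi> (\<lambda>i. w \<bar>\<pi> i\<bar>)"
  have W: "w \<in> ?W \<longleftrightarrow> w \<in> words n x \<and> compat n w \<pi>" for w
    by (simp add: compat_iff_std)
  have mono: "strict_mono_on ?I (?e w)" and par: "\<And>i. i \<in> ?I \<Longrightarrow> \<pi> i < 0 \<longleftrightarrow> odd (w \<bar>\<pi> i\<bar>)"
    and ext: "w \<in> extensional ?I" if "w \<in> ?W" for w
  proof -
    show p: "\<pi> i < 0 \<longleftrightarrow> odd (w \<bar>\<pi> i\<bar>)" if "i \<in> ?I" for i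
      using \<open>w \<in> ?W\<close> that unfolding W by (simp add: compat_def)
    show "strict_mono_on ?I (?e w)"
      using \<open>w \<in> ?W\<close> compat_iff_level[OF \<pi> p] unfolding W by simp
    show "w \<in> extensional ?I"
      using \<open>w \<in> ?W\<close> by (simp add: words_def PiE_def)
  qed
  have "bij_betw (\<lambda>w. ?e w ` ?I) ?W {B. B \<subseteq> ?A \<and> card B = n}"
    unfolding bij_betw_def
  proof (intro conjI inj_onI equalityI subsetI)
    fix w w' assume w: "w \<in> ?W" "w' \<in> ?W" and eq: "?e w ` ?I = ?e w' ` ?I"
    have "w \<bar>\<pi> i\<bar> = w' \<bar>\<pi> i\<bar>" if i: "i \<in> ?I" for i
    proof -
      have "?e w i = ?e w' i"
        using strict_mono_on_unique[OF mono[OF w(1)] mono[OF w(2)] eq i] .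
      then have "(w \<bar>\<pi> i\<bar> + 1) div 2 = (w' \<bar>\<pi> i\<bar> + 1) div 2" by (simp add: level_def)
      moreover have "odd (w \<bar>\<pi> i\<bar>) \<longleftrightarrow> odd (w' \<bar>\<pi> i\<bar>)"
        using par[OF w(1) i] par[OF w(2) i] by simp
      ultimately show ?thesis by presburger
    qed
    then have "w j = w' j" if "j \<in> ?I" for j
      using that hypB_abs_image[OF \<pi>] by (metis (no_types, lifting) imageE)
    then show "w = w'"
      using extensionalityI[OF ext[OF w(1)] ext[OF w(2)]] by simp
  next
    fix B assume "B \<in> (\<lambda>w. ?e w ` ?I) ` ?W"
    then obtain w where w: "w \<in> ?W" "B = ?e w ` ?I" by (rule imageE)
    have "card B = n"
      using card_image[OF strict_mono_on_imp_inj_on[OF mono[OF w(1)]]] w(2) by simp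
    moreover have "B \<subseteq> ?A"
      using compat_words_iff[OF _ n ext[OF w(1)], of \<pi> x] w(1) unfolding W w(2) by blast
    ultimately show "B \<in> {B. B \<subseteq> ?A \<and> card B = n}" by simp
  next
    fix B assume "B \<in> {B. B \<subseteq> ?A \<and> card B = n}"
    then have B: "B \<subseteq> ?A" "card B = n" by auto
    have "finite B" using B(1) by (rule finite_subset) simp
    then obtain e where e: "bij_betw e ?I B" "strict_mono_on ?I e"
      using ex_strict_mono_enumeration B(2) by blast
    \<comment> \<open>This inverts \<open>level\<close>: the correction terms are removed, the half
      is doubled, and the sign of \<open>\<pi> i\<close> fixes the parity.\<close>
    define a where "a i = 2 * (e i - i + descents_upto \<pi> i) - (if \<pi> i < 0 then 1 else 0)" for i
    define w where "w = restrict (\<lambda>j. a \<bar>(inv\<^bsub>hyperoctahedral n\<^esub> \<pi>) j\<bar>) ?I"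
    have wa: "w \<bar>\<pi> i\<bar> = a i" if "i \<in> ?I" for i
      using hypB_abs_inv(1)[OF \<pi>, of i] hypB_abs_in[OF \<pi> that] that by (simp add: w_def)
    have par': "\<pi> i < 0 \<longleftrightarrow> odd (w \<bar>\<pi> i\<bar>)" if "i \<in> ?I" for i
      using wa[OF that] by (simp add: a_def)
    have we: "?e w i = e i" if "i \<in> ?I" for i
      unfolding level_def wa[OF that] a_def by (cases "\<pi> i < 0") simp_all
    have "strict_mono_on ?I (?e w)"
      using e(2) we by (simp add: strict_mono_on_def)
    then have c: "compat n w \<pi>"
      using compat_iff_level[OF \<pi> par'] by simp
    have img: "?e w ` ?I = B"
      using image_cong[OF refl, of ?I "?e w" e] bij_betw_imp_surj_on[OF e(1)] we by simp
    have "w \<in> words n x"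
      using compat_words_iff[OF c n] img B(1) by (simp add: w_def)
    then have "w \<in> ?W" using c W by simp
    then show "B \<in> (\<lambda>w. ?e w ` ?I) ` ?W" using img by (metis (no_types, lifting) image_eqI)
  qed
  then have "word_count n x \<pi> = card {B. B \<subseteq> ?A \<and> card B = n}"
    by (simp add: word_count_def bij_betw_same_card)
  also have "\<dots> = card ?A choose n"
    by (rule n_subsets) simp
  also have "card ?A = nat (int n - int (des_A n \<pi>) + (x - 1 - (if \<pi> 1 < 0 then 1 else 0)) div 2)"
    by simp
  finally show ?thesis .
qed

lemma ceiling_half: "\<lceil>of_int k / 2 :: rat\<rceil> = (k + 1) div 2"
proof -
  have "2 * ((k + 1) div 2) = k \<or> 2 * ((k + 1) div 2) = k + 1" by presburger
  then have "(2 * of_int ((k + 1) div 2) :: rat) = of_int k \<or> (2 * of_int ((k + 1) div 2) :: rat) = of_int k + 1"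
    by (metis of_int_1 of_int_add of_int_mult of_int_numeral)
  then show ?thesis by (intro ceiling_unique) auto
qed

text \<open>The upper index of the binomial is the same on both sides. For positive \<open>x\<close>
  it is non-negative, so the polynomial binomial agrees with the count of subsets.\<close>

lemma zeta_eq_word_count:
  assumes n: "n \<ge> 1" and x: "x \<ge> 1"
  shows "zeta n x \<pi> = of_nat (word_count n x \<pi>)"
proof (cases "\<pi> \<in> hypB n")
  case False
  then have "word_count n x \<pi> = 0" using std_in by (auto simp: word_count_def card_eq_0_iff)
  then show ?thesis using False by (simp add: zeta_def)
next
  case True
  let ?s = "if \<pi> 1 < 0 then 1 else 0 :: int"
  have "card {i \<in> {1..int n - 1}. \<pi> i > \<pi> (i + 1)} \<le> card {1..int n - 1}"
    by (rule card_mono) auto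
  then have d: "int (des_A n \<pi>) \<le> int n - 1" using n by (simp add: des_A_def)
  let ?M = "int n - int (des_A n \<pi>) + (x - 1 - ?s) div 2"
  have "\<lceil>of_int (x - int (fdes n \<pi>)) / 2 :: rat\<rceil> + int n - 1 = ?M"
    unfolding ceiling_half fdes_eq[OF n True] by (cases "\<pi> 1 < 0"; simp; presburger)
  then have "zeta n x \<pi> = of_int ?M gchoose n"
    using True by (simp only: zeta_def if_True)
  \<comment> \<open>The bound -1 is attained at \<open>x = 1\<close> with
    \<open>\<pi> 1 < 0\<close>; having at most \<open>n - 1\<close> descents compensates for
    it.\<close>
  moreover have "(x - 1 - ?s) div 2 \<ge> - 1" using x by (cases "\<pi> 1 < 0") auto
  then have "(of_int ?M :: rat) = of_nat (nat ?M)" using d by (intro of_nat_nat[symmetric]) linarith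
  ultimately show ?thesis
    by (simp only: word_count_eq_binomial[OF True n] binomial_gbinomial)
qed

section \<open>Extension to all integers\<close>

definition polyfun :: "(int \<Rightarrow> 'a::idom) \<Rightarrow> bool" where
  "polyfun f \<longleftrightarrow> (\<exists>p. \<forall>u. f u = poly p (of_int u))"

lemma polyfun_const: "polyfun (\<lambda>_. c)"
  unfolding polyfun_def by (rule exI[of _ "[:c:]"]) simp

lemma polyfun_of_int: "polyfun of_int"
  unfolding polyfun_def by (rule exI[of _ "[:0, 1:]"]) simp

lemma polyfun_add:
  assumes "polyfun f" "polyfun g" shows "polyfun (\<lambda>u. f u + g u)"
proof -
  obtain p q where "\<forall>u. f u = poly p (of_int u)" "\<forall>u. g u = poly q (of_int u)"
    using assms by (auto simp: polyfun_def)
  then have "\<forall>u. f u + g u = poly (p + q) (of_int u)" by simp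
  then show ?thesis unfolding polyfun_def by blast
qed

lemma polyfun_mult:
  assumes "polyfun f" "polyfun g" shows "polyfun (\<lambda>u. f u * g u)"
proof -
  obtain p q where "\<forall>u. f u = poly p (of_int u)" "\<forall>u. g u = poly q (of_int u)"
    using assms by (auto simp: polyfun_def)
  then have "\<forall>u. f u * g u = poly (p * q) (of_int u)" by simp
  then show ?thesis unfolding polyfun_def by blast
qed

lemma polyfun_sum:
  "(\<And>i. i \<in> A \<Longrightarrow> polyfun (f i)) \<Longrightarrow> polyfun (\<lambda>u. \<Sum>i\<in>A. f i u)"
  by (induction A rule: infinite_finite_induct) (auto intro: polyfun_const polyfun_add)

lemma polyfun_prod:
  "(\<And>i. i \<in> A \<Longrightarrow> polyfun (f i)) \<Longrightarrow> polyfun (\<lambda>u. \<Prod>i\<in>A. f i u)"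
  by (induction A rule: infinite_finite_induct) (auto intro: polyfun_const polyfun_mult)

lemma polyfun_gbinomial:
  "polyfun (\<lambda>u. (of_int (a * u + b) :: 'a::field_char_0) gchoose n)"
proof -
  have "(of_int (a * u + b) :: 'a) gchoose n =
    inverse (fact n) * (\<Prod>i = 0..<n. of_int a * of_int u + of_int (b - int i))" for u
    by (simp add: gbinomial_prod_rev field_simps)
  then show ?thesis
    by (auto intro!: polyfun_mult polyfun_prod polyfun_add polyfun_const polyfun_of_int)
qed

text \<open>In characteristic 0 the positive integers give infinitely many roots.\<close>

lemma polyfun_eq_zero:
  fixes f :: "int \<Rightarrow> 'a::{idom, ring_char_0}"
  assumes "polyfun f" "\<And>u. u \<ge> 1 \<Longrightarrow> f u = 0"
  shows "f u = 0"
proof -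
  obtain p where p: "\<And>u. f u = poly p (of_int u)" using assms(1) by (auto simp: polyfun_def)
  have "of_int ` {1..} \<subseteq> {z. poly p z = 0}" using p assms(2) by auto
  moreover have "infinite ((of_int :: int \<Rightarrow> 'a) ` {1..})"
    using finite_imageD[of "of_int :: int \<Rightarrow> 'a" "{1..}"] infinite_Ici by (auto simp: inj_on_def)
  ultimately have "p = 0" using poly_roots_finite finite_subset by blast
  then show ?thesis using p by simp
qed

text \<open>Quasi-polynomials of period 2. Letting \<open>r\<close> be any integer avoids a case
  split on parity.\<close>

definition quasi_polyfun :: "(int \<Rightarrow> rat) \<Rightarrow> bool" where
  "quasi_polyfun f \<longleftrightarrow> (\<forall>r. polyfun (\<lambda>u. f (2 * u + r)))"

text \<open>Replacing \<open>x\<close> by \<open>2 * u + r\<close> adds the even number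
  \<open>2 * (y * u)\<close> before halving, so \<open>y * u\<close> splits off from the rounding.
  The factor \<open>y\<close> covers the product as well as, for \<open>y = 1\<close>, a single
  argument.\<close>

lemma quasi_polyfun_zeta: "quasi_polyfun (\<lambda>x. zeta n (x * y) \<pi>)"
  unfolding quasi_polyfun_def
proof
  fix r
  have *: "((2 * u + r) * y - int (fdes n \<pi>) + 1) div 2 + int n - 1 =
    y * u + ((r * y - int (fdes n \<pi>) + 1) div 2 + int n - 1)" for u
  proof -
    have "(2 * u + r) * y - int (fdes n \<pi>) + 1 = (r * y - int (fdes n \<pi>) + 1) + 2 * (y * u)"
      by (simp add: algebra_simps)
    then show ?thesis by simp
  qed
  show "polyfun (\<lambda>u. zeta n ((2 * u + r) * y) \<pi>)"
    unfolding zeta_def ceiling_half *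
    by (cases "\<pi> \<in> hypB n") (simp_all only: polyfun_gbinomial polyfun_const if_True if_False)
qed

lemma quasi_polyfun_eq:
  assumes f: "quasi_polyfun f" and g: "quasi_polyfun g" and eq: "\<And>x. x \<ge> 1 \<Longrightarrow> f x = g x"
  shows "f x = g x"
proof -
  \<comment> \<open>A residue in {0, 1} keeps \<open>2 * u + r\<close> positive for every
    \<open>u \<ge> 1\<close>.\<close>
  define r where "r = x mod 2"
  have "polyfun (\<lambda>u. f (2 * u + r) + (- 1) * g (2 * u + r))"
    using f g unfolding quasi_polyfun_def by (intro polyfun_add polyfun_mult polyfun_const) auto
  moreover have "f (2 * u + r) + (- 1) * g (2 * u + r) = 0" if "u \<ge> 1" for u
    using eq[of "2 * u + r"] that by (simp add: r_def)
  ultimately have "f (2 * (x div 2) + r) + (- 1) * g (2 * (x div 2) + r) = 0"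
    by (rule polyfun_eq_zero)
  then show ?thesis by (simp add: r_def)
qed

theorem theorem2p6p5:
  fixes n :: nat and x y :: int
  assumes "n \<ge> 1"
  shows "zeta n x \<otimes>\<^bsub>group_algebra (hyperoctahedral n)\<^esub> zeta n y = zeta n (x * y)"
proof
  fix \<pi>
  let ?T = "{(\<sigma>, \<tau>). \<sigma> \<in> hypB n \<and> \<tau> \<in> hypB n \<and> \<sigma> \<circ> \<tau> = \<pi>}"
  \<comment> \<open>This is the coefficient of \<pi> in the product, summed over an index set
    independent of \<open>x\<close> and \<open>y\<close>, so that quasi-polynomiality passes to the
    sum.\<close>
  define P where "P x y = (\<Sum>(\<sigma>, \<tau>)\<in>?T. zeta n x \<sigma> * zeta n y \<tau>)" for x y
  have fT: "finite ?T"
    by (rule finite_subset[of _ "hypB n \<times> hypB n"]) (auto simp: finite_hypB)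
  have zeta1: "quasi_polyfun (\<lambda>x. zeta n x \<sigma>)" for \<sigma>
    using quasi_polyfun_zeta[of n 1 \<sigma>] by simp
  have pos: "P x y = zeta n (x * y) \<pi>" if "x \<ge> 1" "y \<ge> 1" for x y
  proof -
    have "x * y \<ge> 1" using mult_mono[of 1 x 1 y] that by simp
    then show ?thesis
      using that word_count_mult[of x n y \<pi>]
      by (simp add: P_def zeta_eq_word_count[OF assms] case_prod_unfold)
  qed
  \<comment> \<open>One variable is extended at a time: first \<open>x\<close> with \<open>y\<close>
    positive, then \<open>y\<close> with \<open>x\<close> arbitrary.\<close>
  have right: "P x y = zeta n (x * y) \<pi>" if "y \<ge> 1" for x y
  proof (rule quasi_polyfun_eq[of "\<lambda>x. P x y" "\<lambda>x. zeta n (x * y) \<pi>"])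
    show "quasi_polyfun (\<lambda>x. P x y)"
      using zeta1 unfolding P_def quasi_polyfun_def case_prod_unfold
      by (intro allI polyfun_sum polyfun_mult polyfun_const) blast
  qed (use pos that quasi_polyfun_zeta in auto)
  have "P x y = zeta n (x * y) \<pi>"
  proof (rule quasi_polyfun_eq[of "\<lambda>y. P x y" "\<lambda>y. zeta n (x * y) \<pi>"])
    show "quasi_polyfun (\<lambda>y. P x y)"
      using zeta1 unfolding P_def quasi_polyfun_def case_prod_unfold
      by (intro allI polyfun_sum polyfun_mult polyfun_const) blast
    show "quasi_polyfun (\<lambda>y. zeta n (x * y) \<pi>)"
      using quasi_polyfun_zeta[of n x \<pi>] by (simp add: mult.commute)
  qed (use right in auto)
  moreover have "(zeta n x \<otimes>\<^bsub>group_algebra (hyperoctahedral n)\<^esub> zeta n y) \<pi> = P x y"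
  proof -
    let ?T' = "{(\<sigma>, \<tau>). zeta n x \<sigma> \<noteq> 0 \<and> zeta n y \<tau> \<noteq> 0 \<and> \<sigma> \<circ> \<tau> = \<pi>}"
    \<comment> \<open>The algebra product sums only over pairs with non-zero coefficients; the
      remaining pairs of \<open>?T\<close> contribute 0.\<close>
    have "?T' \<subseteq> ?T" by (auto simp: zeta_def split: if_splits)
    then have "(\<Sum>(\<sigma>, \<tau>)\<in>?T'. zeta n x \<sigma> * zeta n y \<tau>) = P x y"
      unfolding P_def by (intro sum.mono_neutral_left fT) auto
    then show ?thesis by (simp add: group_algebra_def hyperoctahedral_def)
  qed
  ultimately show "(zeta n x \<otimes>\<^bsub>group_algebra (hyperoctahedral n)\<^esub> zeta n y) \<pi> = zeta n (x * y) \<pi>"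
    by simp
qed

end
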